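(* Consider the generalized Riemann problem for the 1D ten-moment equations with source in the acoustic case. Then, for $K=L,R$, $$\left(\tfrac{\partial u_2}{\partial t}\right)_{\ast K}=\left(\tfrac{\mathcal D u_2}{\mathcal D t}\right)_{\ast K}+\frac{u_{1,\ast}}{p_{11,\ast}}\left[\left(\tfrac{\mathcal D p_{12}}{\mathcal D t}\right)_{\ast K}-\frac{2p_{12,\ast}}{3p_{11,\ast}}\left(\tfrac{\mathcal D p_{11}}{\mathcal D t}\right)_\ast\right],\qquad \left(\tfrac{\partial p_{12}}{\partial t}\right)_{\ast K}=\left(\tfrac{\mathcal D p_{12}}{\mathcal D t}\right)_{\ast K}+\rho_\ast u_{1,\ast}\left(\tfrac{\mathcal D u_2}{\mathcal D t}\right)_{\ast K},$$ $$\left(\tfrac{\partial p_{22}}{\partial t}\right)_{\ast K}=\left(\tfrac{\mathcal D p_{22}}{\mathcal D t}\right)_{\ast K}-u_{1,\ast}\left(\tfrac{\partial p_{22}}{\partial x}\right)_{\ast K},\qquad \left(\tfrac{\mathcal D p_{22}}{\mathcal D t}\right)_{\ast K}=\frac{p_{11,\ast}p_{22,\ast}-4p_{12,\ast}^2}{3p_{11,\ast}^2}\left(\tfrac{\mathcal D p_{11}}{\mathcal D t}\right)_\ast+\frac{2p_{12,\ast}}{p_{11,\ast}}\left(\tfrac{\mathcal D p_{12}}{\mathcal D t}\right)_{\ast K},$$ where $$\left(\tfrac{\mathcal D p_{11}}{\mathcal D t}\right)_\ast=\frac{3p_{11,\ast}}{2c_\ast}\left[\frac1{\rho_\ast}(p_{11,R}'-p_{11,L}')-c_\ast(u_{1,L}'+u_{1,R}')\right],$$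 $$\left(\tfrac{\mathcal D u_2}{\mathcal D t}\right)_{\ast L}=-\frac{p_{12,L}'}{\rho_L}-\frac{c_\ast p_{12,L}}{p_{11,\ast}}u_{1,L}'-\frac{p_{12,\ast}c_\ast}{3p_{11,\ast}^2}\left(\tfrac{\mathcal D p_{11}}{\mathcal D t}\right)_\ast,\qquad \left(\tfrac{\mathcal D u_2}{\mathcal D t}\right)_{\ast R}=-\frac{p_{12,R}'}{\rho_R}+\frac{c_\ast p_{12,R}}{p_{11,\ast}}u_{1,R}'+\frac{p_{12,\ast}c_\ast}{3p_{11,\ast}^2}\left(\tfrac{\mathcal D p_{11}}{\mathcal D t}\right)_\ast,$$ $$\left(\tfrac{\mathcal D p_{12}}{\mathcal D t}\right)_{\ast K}=\frac{p_{12,\ast}}{p_{11,\ast}}\left(\tfrac{\mathcal D p_{11}}{\mathcal D t}\right)_\ast+p_{12,K}u_{1,K}'-p_{11,K}u_{2,K}',$$ $$\left(\tfrac{\partial p_{22}}{\partial x}\right)_{\ast L}=\frac1{c_\ast}\left[\left(\tfrac{\mathcal D p_{22}}{\mathcal D t}\right)_{\ast L}+p_{22,L}u_{1,L}'+2p_{12,L}u_{2,L}'+c_\ast p_{22,L}'\right],$$ $$\left(\tfrac{\partial p_{22}}{\partial x}\right)_{\ast R}=\frac1{c_\ast}\left[-p_{22,R}u_{1,R}'-2p_{12,R}u_{2,R}'+c_\ast p_{22,R}'-\left(\tfrac{\mathcal D p_{22}}{\mathcal D t}\right)_{\ast R}\right].$$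
   Context: **System.** $\mathbf V=(\rho,u_1,u_2,p_{11},p_{12},p_{22})^\top$ with $\rho>0$, $p_{11}>0$, $p_{11}p_{22}-p_{12}^2>0$; $W(x)$ is a given $C^1$ potential; $c=\sqrt{3p_{11}/\rho}$; $\frac{\mathcal D}{\mathcal D t}=\partial_t+u_1\partial_x$. Smooth solutions satisfy: $\frac{\mathcal D\rho}{\mathcal D t}+\rho\partial_xu_1=0$; $\frac{\mathcal D u_1}{\mathcal D t}+\frac1\rho\partial_xp_{11}=-\frac12W_x$; $\frac{\mathcal D u_2}{\mathcal D t}+\frac1\rho\partial_xp_{12}=0$; $\frac{\mathcal D p_{11}}{\mathcal D t}+3p_{11}\partial_xu_1=0$; $\frac{\mathcal D p_{12}}{\mathcal D t}+2p_{12}\partial_xu_1+p_{11}\partial_xu_2=0$; $\frac{\mathcal D p_{22}}{\mathcal D t}+p_{22}\partial_xu_1+2p_{12}\partial_xu_2=0$. **Generalized Riemann problem, acoustic case.** Initial data $\mathbf V_L+x\mathbf V_L'$ for $x<0$, $\mathbf V_R+x\mathbf V_R'$ for $x>0$, with constant vectors $\mathbf V_K=(\rho_K,u_{1,K},u_{2,K},p_{11,K},p_{12,K},p_{22,K})^\top$, $\mathbf V_K'=(\rho_K',u_{1,K}',u_{2,K}',p_{11,K}',p_{12,K}',p_{22,K}')^\top$, where $\mathbf V_L=\mathbf V_R=:\mathbf V_\ast=(\rho_\ast,u_{1,\ast},u_{2,\ast},p_{11,\ast},p_{12,\ast},p_{22,\ast})^\top$ but $\mathbf V_L'\neq\mathbf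 V_R'$; $c_\ast=\sqrt{3p_{11,\ast}/\rho_\ast}$. Only linear (acoustic) waves leave the origin: the solution is continuous near $(0,0)$, $0\le t\ll1$, and smooth (with derivatives having limits at $(0,0)$) in the regions separated by smooth characteristic curves from the origin with speeds $u_1-c$ (1-wave), $u_1-\frac c{\sqrt3}$ (2-wave), $u_1$ (contact), $u_1+\frac c{\sqrt3}$ (5-wave), $u_1+c$ (6-wave). The four regions between consecutive curves are, from left to right, $\ast L,\ast\ast L,\ast\ast R,\ast R$; a region subscript denotes the limit at $(0,0)$ from that region. The limit of $\frac{\mathcal D p_{11}}{\mathcal D t}$ is the same in all four regions and carries the subscript $\ast$. *)

theory Defs
  imports "HOL-Analysis.Analysis"
begin

text \<open>
  States are vectors \<open>V = (\<rho>, u\<^sub>1, u\<^sub>2, p\<^sub>1\<^sub>1, p\<^sub>1\<^sub>2, p\<^sub>2\<^sub>2)\<close>; the accessors below are also applied to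
  derivatives of states, so that e.g. \<open>u2 (pdt V p)\<close> is \<open>\<partial>u\<^sub>2/\<partial>t\<close> at \<open>p\<close>.
  Points of space-time are pairs \<open>(t, x)\<close>.
\<close>

abbreviation rho :: "real^6 \<Rightarrow> real" where "rho v \<equiv> v $ 1"
abbreviation u1 :: "real^6 \<Rightarrow> real" where "u1 v \<equiv> v $ 2"
abbreviation u2 :: "real^6 \<Rightarrow> real" where "u2 v \<equiv> v $ 3"
abbreviation p11 :: "real^6 \<Rightarrow> real" where "p11 v \<equiv> v $ 4"
abbreviation p12 :: "real^6 \<Rightarrow> real" where "p12 v \<equiv> v $ 5"
abbreviation p22 :: "real^6 \<Rightarrow> real" where "p22 v \<equiv> v $ 6"

definition admissible :: "real^6 \<Rightarrow> bool" where
  "admissible v \<longleftrightarrow> rho v > 0 \<and> p11 v > 0 \<and> p11 v * p22 v - (p12 v)\<^sup>2 > 0"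

definition sound_speed :: "real^6 \<Rightarrow> real" where
  "sound_speed v = sqrt (3 * p11 v / rho v)"

definition pdt :: "(real \<times> real \<Rightarrow> real^6) \<Rightarrow> real \<times> real \<Rightarrow> real^6" where
  "pdt V p = vector_derivative (\<lambda>t. V (t, snd p)) (at (fst p))"

definition pdx :: "(real \<times> real \<Rightarrow> real^6) \<Rightarrow> real \<times> real \<Rightarrow> real^6" where
  "pdx V p = vector_derivative (\<lambda>x. V (fst p, x)) (at (snd p))"

definition material_deriv :: "(real \<times> real \<Rightarrow> real^6) \<Rightarrow> real \<times> real \<Rightarrow> real^6" where
  "material_deriv V p = pdt V p + u1 (V p) *\<^sub>R pdx V p"

definition ten_moment_at ::
    "(real \<Rightarrow> real) \<Rightarrow> (real \<times> real \<Rightarrow> real^6) \<Rightarrow> real \<times> real \<Rightarrow> bool" where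
  "ten_moment_at W V p \<longleftrightarrow>
    (let v = V p; vx = pdx V p; D = material_deriv V p in
      rho D + rho v * u1 vx = 0 \<and>
      u1 D + 1 / rho v * p11 vx = - (1/2) * deriv W (snd p) \<and>
      u2 D + 1 / rho v * p12 vx = 0 \<and>
      p11 D + 3 * p11 v * u1 vx = 0 \<and>
      p12 D + 2 * p12 v * u1 vx + p11 v * u2 vx = 0 \<and>
      p22 D + p22 v * u1 vx + 2 * p12 v * u2 vx = 0)"

text \<open>The contact is the wave of the double eigenvalue \<open>u\<^sub>1\<close> (families 3 and 4).\<close>

datatype wave = Wave1 | Wave2 | Contact | Wave5 | Wave6

fun wave_speed :: "wave \<Rightarrow> real^6 \<Rightarrow> real" where
  "wave_speed Wave1 v = u1 v - sound_speed v"
| "wave_speed Wave2 v = u1 v - sound_speed v / sqrt 3"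
| "wave_speed Contact v = u1 v"
| "wave_speed Wave5 v = u1 v + sound_speed v / sqrt 3"
| "wave_speed Wave6 v = u1 v + sound_speed v"

text \<open>
  Everything takes place in the box \<open>0 \<le> t < T\<close>, \<open>\<bar>x\<bar> < r\<close>, with \<open>T, r > 0\<close> arbitrary.
\<close>

definition box_at_origin :: "real \<Rightarrow> real \<Rightarrow> (real \<times> real) set" where
  "box_at_origin T r = {0..<T} \<times> {-r<..<r}"

definition characteristic_from_origin ::
    "real \<Rightarrow> real \<Rightarrow> (real \<times> real \<Rightarrow> real^6) \<Rightarrow> wave \<Rightarrow> (real \<Rightarrow> real) \<Rightarrow> bool" where
  "characteristic_from_origin T r V w X \<longleftrightarrow>
    X 0 = 0 \<and>
    (\<forall>t\<in>{0..<T}. \<bar>X t\<bar> < r \<and>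
       (X has_real_derivative wave_speed w (V (t, X t))) (at t within {0..<T}))"

text \<open>
  From left to right the regions are \<open>Outer L\<close>, \<open>Star L\<close> (\<open>\<ast>L\<close>), \<open>StarStar L\<close> (\<open>\<ast>\<ast>L\<close>),
  \<open>StarStar R\<close> (\<open>\<ast>\<ast>R\<close>), \<open>Star R\<close> (\<open>\<ast>R\<close>), \<open>Outer R\<close>. The curves need not be assumed ordered: their
  speeds at the origin are distinct, so they are ordered for small \<open>t > 0\<close>, and in
  particular the origin is a limit point of every region.
\<close>

datatype side = L | R

datatype region = Outer side | Star side | StarStar side

fun region_set :: "real \<Rightarrow> real \<Rightarrow> (wave \<Rightarrow> real \<Rightarrow> real) \<Rightarrow> region \<Rightarrow> (real \<times> real) set" where
  "region_set T r X (Outer L) = {(t, x). 0 < t \<and> t < T \<and> - r < x \<and> x < X Wave1 t}"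
| "region_set T r X (Star L) = {(t, x). 0 < t \<and> t < T \<and> X Wave1 t < x \<and> x < X Wave2 t}"
| "region_set T r X (StarStar L) = {(t, x). 0 < t \<and> t < T \<and> X Wave2 t < x \<and> x < X Contact t}"
| "region_set T r X (StarStar R) = {(t, x). 0 < t \<and> t < T \<and> X Contact t < x \<and> x < X Wave5 t}"
| "region_set T r X (Star R) = {(t, x). 0 < t \<and> t < T \<and> X Wave5 t < x \<and> x < X Wave6 t}"
| "region_set T r X (Outer R) = {(t, x). 0 < t \<and> t < T \<and> X Wave6 t < x \<and> x < r}"

text \<open>Smoothness is required only as \<open>C\<^sup>1\<close> in the open region.\<close>

definition smooth_with_limits :: "(real \<times> real \<Rightarrow> real^6) \<Rightarrow> (real \<times> real) set \<Rightarrow> bool" where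
  "smooth_with_limits V S \<longleftrightarrow>
    (\<forall>p\<in>S. V differentiable (at p)) \<and>
    continuous_on S (pdt V) \<and> continuous_on S (pdx V) \<and>
    (\<exists>l. (pdt V \<longlongrightarrow> l) (at (0, 0) within S)) \<and>
    (\<exists>l. (pdx V \<longlongrightarrow> l) (at (0, 0) within S))"

text \<open>
  The acoustic generalized Riemann problem and its local solution \<open>V\<close>: \<open>V0 K + x *\<^sub>R V0' K\<close> are
  the initial data on side \<open>K\<close>, and \<open>X w\<close> is the characteristic curve of the wave \<open>w\<close>.
\<close>

definition acoustic_GRP_solution ::
    "(real \<Rightarrow> real) \<Rightarrow> (side \<Rightarrow> real^6) \<Rightarrow> (side \<Rightarrow> real^6) \<Rightarrow> real^6 \<Rightarrow> real \<Rightarrow> real \<Rightarrow>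
     (wave \<Rightarrow> real \<Rightarrow> real) \<Rightarrow> (real \<times> real \<Rightarrow> real^6) \<Rightarrow> bool" where
  "acoustic_GRP_solution W V0 V0' Vs T r X V \<longleftrightarrow>
    W C1_differentiable_on UNIV \<and>
    V0 L = Vs \<and> V0 R = Vs \<and> V0' L \<noteq> V0' R \<and>
    T > 0 \<and> r > 0 \<and>
    continuous_on (box_at_origin T r) V \<and>
    (\<forall>p\<in>box_at_origin T r. admissible (V p)) \<and>
    (\<forall>x. - r < x \<and> x < 0 \<longrightarrow> V (0, x) = V0 L + x *\<^sub>R V0' L) \<and>
    (\<forall>x. 0 < x \<and> x < r \<longrightarrow> V (0, x) = V0 R + x *\<^sub>R V0' R) \<and>
    (\<forall>w. characteristic_from_origin T r V w (X w)) \<and>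
    (\<forall>Q. smooth_with_limits V (region_set T r X Q) \<and>
         (\<forall>p\<in>region_set T r X Q. ten_moment_at W V p))"

text \<open>The subscripted quantities: limits at the origin from within a set of space-time points.\<close>

definition origin_limit :: "(real \<times> real) set \<Rightarrow> (real \<times> real \<Rightarrow> real^6) \<Rightarrow> real^6" where
  "origin_limit S F = Lim (at (0, 0) within S) F"

end

theory Submission
  imports Defs
begin

text \<open>
  Everything reduces to linear algebra at the origin. In each region \<open>Q\<close> let \<open>A\<close> and \<open>B\<close> be the
  limits of \<open>\<partial>\<^sub>tV\<close> and \<open>\<partial>\<^sub>xV\<close>, and \<open>D = A + u\<^sub>1 B\<close> the limit of the material derivative. Three facts
  determine what is needed of them.

  First, passing to the limit in the system gives six linear equations between \<open>D\<close> and \<open>B\<close>, with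
  coefficients frozen at the common state \<open>Vs\<close> and the same source \<open>W'(0)\<close> in all regions
  (\<open>balance_at_origin\<close>). Secondly, in the outer regions \<open>B\<close> is the slope of the initial data
  (\<open>outer_slope\<close>). Thirdly, \<open>V\<close> is continuous across each characteristic curve \<open>x = X(t)\<close>, and the
  mean value inequality applied inside the adjacent region shows that \<open>V(t, X(t)) - V(0, 0)\<close> is
  \<open>t (A + s B) + o(t)\<close>, where \<open>s = X'(0)\<close>; hence \<open>A + s B\<close>, or equivalently \<open>D + (s - u\<^sub>1) B\<close>, is the
  same on both sides (\<open>difference_quotient_along_boundary_curve\<close>, \<open>jump_relation\<close>).

  Consequently the jump of \<open>B\<close> across a wave is an eigenvector for that wave. For the contact and
  the waves of relative speed \<open>\<plusminus> c / \<surd>3\<close> it has no \<open>u\<^sub>1\<close>- and \<open>p\<^sub>1\<^sub>1\<close>-components, so these slopes and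
  \<open>D p\<^sub>1\<^sub>1\<close> agree in all four intermediate regions
  (\<open>slopes_continuous_across_nonacoustic_wave\<close>). Across the waves of relative speed \<open>\<minusplus> c\<close> the
  quantity \<open>D p\<^sub>1\<^sub>1 \<minusplus> c \<partial>\<^sub>xp\<^sub>1\<^sub>1\<close> is known from the data; adding the left and the right relation
  eliminates \<open>\<partial>\<^sub>xp\<^sub>1\<^sub>1\<close> and gives \<open>D p\<^sub>1\<^sub>1\<close>. The same jump relations then transport \<open>u\<^sub>2\<close>, \<open>p\<^sub>1\<^sub>2\<close> and
  \<open>p\<^sub>2\<^sub>2\<close> from the outer regions to the adjacent starred ones (\<open>relations_across_acoustic_wave\<close>).
\<close>

section \<open>First-order behaviour along curves through the origin\<close>

lemma pdt_pdx_derivative: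
  assumes "V differentiable (at (t, y))"
  shows "(V has_derivative (\<lambda>h. fst h *\<^sub>R pdt V (t, y) + snd h *\<^sub>R pdx V (t, y))) (at (t, y))"
proof -
  obtain V' where V': "(V has_derivative V') (at (t, y))"
    using assms unfolding differentiable_def by blast
  interpret V': bounded_linear V'
    using V' by (rule has_derivative_bounded_linear)
  have "((\<lambda>\<tau>. V (\<tau>, y)) has_derivative (\<lambda>h. V' (h, 0))) (at t)"
    by (rule has_derivative_compose[where f="\<lambda>\<tau>. (\<tau>, y)", OF _ V'])
      (auto intro!: derivative_eq_intros)
  moreover have "V' (h, 0) = h *\<^sub>R V' (1, 0)" for h
    using V'.scaleR[of h "(1, 0)"] by simp
  ultimately have "((\<lambda>\<tau>. V (\<tau>, y)) has_vector_derivative V' (1, 0)) (at t)"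
    unfolding has_vector_derivative_def by (elim has_derivative_eq_rhs) (rule ext)
  then have t: "pdt V (t, y) = V' (1, 0)"
    unfolding pdt_def by (simp add: vector_derivative_at)
  have "((\<lambda>\<xi>. V (t, \<xi>)) has_derivative (\<lambda>h. V' (0, h))) (at y)"
    by (rule has_derivative_compose[where f="\<lambda>\<xi>. (t, \<xi>)", OF _ V'])
      (auto intro!: derivative_eq_intros)
  moreover have "V' (0, h) = h *\<^sub>R V' (0, 1)" for h
    using V'.scaleR[of h "(0, 1)"] by simp
  ultimately have "((\<lambda>\<xi>. V (t, \<xi>)) has_vector_derivative V' (0, 1)) (at y)"
    unfolding has_vector_derivative_def by (elim has_derivative_eq_rhs) (rule ext)
  then have x: "pdx V (t, y) = V' (0, 1)"
    unfolding pdx_def by (simp add: vector_derivative_at)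
  have "V' h = fst h *\<^sub>R pdt V (t, y) + snd h *\<^sub>R pdx V (t, y)" for h
  proof -
    have "h = fst h *\<^sub>R (1, 0) + snd h *\<^sub>R (0, 1)" by (simp add: prod_eq_iff)
    then have "V' h = V' (fst h *\<^sub>R (1, 0) + snd h *\<^sub>R (0, 1))" by (rule arg_cong)
    then show ?thesis unfolding t x V'.add V'.scaleR .
  qed
  then have "V' = (\<lambda>h. fst h *\<^sub>R pdt V (t, y) + snd h *\<^sub>R pdx V (t, y))" ..
  then show ?thesis using V' by simp
qed

lemma vector_derivative_along_curve:
  assumes "V differentiable (at (t, Y t))" and "(Y has_real_derivative m) (at t)"
  shows "((\<lambda>\<tau>. V (\<tau>, Y \<tau>)) has_vector_derivative
          pdt V (t, Y t) + m *\<^sub>R pdx V (t, Y t)) (at t)"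
proof -
  have "((\<lambda>\<tau>. (\<tau>, Y \<tau>)) has_derivative (\<lambda>h. (h, h * m))) (at t)"
    using assms(2) by (auto intro!: derivative_eq_intros simp: has_field_derivative_def mult.commute)
  from has_derivative_compose[OF this pdt_pdx_derivative[OF assms(1)]]
  show ?thesis by (simp add: has_vector_derivative_def scaleR_right_distrib)
qed

lemma vector_derivative_in_space:
  assumes "V differentiable (at (t, x))"
  shows "((\<lambda>\<xi>. V (t, \<xi>)) has_vector_derivative pdx V (t, x)) (at x)"
proof -
  have "((\<lambda>\<xi>. (t, \<xi>)) has_derivative (\<lambda>h. (0, h))) (at x)"
    by (auto intro!: derivative_eq_intros)
  from has_derivative_compose[OF this pdt_pdx_derivative[OF assms]]
  show ?thesis by (simp add: has_vector_derivative_def)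
qed

lemma dist_origin_le: "dist (t, x) (0, 0) \<le> \<bar>t\<bar> + \<bar>x::real\<bar>" for t :: real
  by (simp add: dist_prod_def sqrt_sum_squares_le_sum_abs)

text \<open>
  The mean value inequality for \<open>V(t, x) - t A - x B\<close> along the curve \<open>Y\<close>: its derivative is
  \<open>(\<partial>\<^sub>tV - A) + Y' (\<partial>\<^sub>xV - B)\<close>.
\<close>

lemma norm_increment_along_curve_le:
  fixes V :: "real \<times> real \<Rightarrow> real^6"
  assumes "0 < t"
    and cont: "continuous_on {0..t} (\<lambda>\<tau>. V (\<tau>, Y \<tau>))" and contY: "continuous_on {0..t} Y"
    and diff: "\<And>\<tau>. 0 < \<tau> \<Longrightarrow> \<tau> < t \<Longrightarrow> V differentiable (at (\<tau>, Y \<tau>))"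
    and derY: "\<And>\<tau>. 0 < \<tau> \<Longrightarrow> \<tau> < t \<Longrightarrow> (Y has_real_derivative Y' \<tau>) (at \<tau>)"
    and A: "\<And>\<tau>. 0 < \<tau> \<Longrightarrow> \<tau> < t \<Longrightarrow> norm (pdt V (\<tau>, Y \<tau>) - A) \<le> e"
    and B: "\<And>\<tau>. 0 < \<tau> \<Longrightarrow> \<tau> < t \<Longrightarrow> norm (pdx V (\<tau>, Y \<tau>) - B) \<le> e"
    and M: "\<And>\<tau>. 0 < \<tau> \<Longrightarrow> \<tau> < t \<Longrightarrow> \<bar>Y' \<tau>\<bar> \<le> M"
  shows "norm (V (t, Y t) - V (0, Y 0) - t *\<^sub>R A - (Y t - Y 0) *\<^sub>R B) \<le> (e + M * e) * t"
proof -
  let ?g = "\<lambda>\<tau>. V (\<tau>, Y \<tau>) - \<tau> *\<^sub>R A - Y \<tau> *\<^sub>R B"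
  let ?g' = "\<lambda>\<tau>. (pdt V (\<tau>, Y \<tau>) - A) + Y' \<tau> *\<^sub>R (pdx V (\<tau>, Y \<tau>) - B)"
  have "norm (?g t - ?g 0) \<le> (e + M * e) * t - (e + M * e) * 0"
  proof (rule differentiable_bound_general[where f'="?g'" and \<phi>'="\<lambda>_. e + M * e"])
    show "continuous_on {0..t} ?g" by (intro continuous_intros cont contY)
    show "continuous_on {0..t} (\<lambda>\<tau>. (e + M * e) * \<tau>)" by (intro continuous_intros)
    fix \<tau> assume \<tau>: "0 < \<tau>" "\<tau> < t"
    show "((\<lambda>\<tau>. (e + M * e) * \<tau>) has_vector_derivative e + M * e) (at \<tau>)"
      by (auto intro!: derivative_eq_intros simp flip: has_real_derivative_iff_has_vector_derivative)
    have Y: "((\<lambda>\<tau>. Y \<tau> *\<^sub>R B) has_vector_derivative Y' \<tau> *\<^sub>R B) (at \<tau>)"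
      using derY[OF \<tau>] by (auto intro!: derivative_eq_intros)
    have "(?g has_vector_derivative
        (pdt V (\<tau>, Y \<tau>) + Y' \<tau> *\<^sub>R pdx V (\<tau>, Y \<tau>)) - 1 *\<^sub>R A - Y' \<tau> *\<^sub>R B) (at \<tau>)"
      by (intro has_vector_derivative_diff vector_derivative_along_curve diff derY \<tau> Y)
        (auto intro!: derivative_eq_intros)
    then show "(?g has_vector_derivative ?g' \<tau>) (at \<tau>)"
      by (simp add: algebra_simps)
    have "norm (?g' \<tau>) \<le> norm (pdt V (\<tau>, Y \<tau>) - A) + \<bar>Y' \<tau>\<bar> * norm (pdx V (\<tau>, Y \<tau>) - B)"
      by (rule order_trans[OF norm_triangle_ineq]) simp
    also have "\<dots> \<le> e + M * e"
      using A[OF \<tau>] B[OF \<tau>] M[OF \<tau>] by (intro add_mono mult_mono) auto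
    finally show "norm (?g' \<tau>) \<le> e + M * e" .
  qed (fact \<open>0 < t\<close>)
  then show ?thesis by (simp add: algebra_simps)
qed

lemma tendsto_origin_along_curve:
  assumes S: "\<forall>\<^sub>F t in at_right 0. (t, Y t) \<in> S" and Y: "(Y \<longlongrightarrow> 0) (at_right 0)"
  shows "filterlim (\<lambda>t. (t, Y t)) (at (0::real, 0::real) within S) (at_right 0)"
proof -
  have "((\<lambda>t. (t, Y t)) \<longlongrightarrow> (0, 0)) (at_right 0)"
    by (intro tendsto_Pair Y tendsto_ident_at)
  moreover have "\<forall>\<^sub>F t in at_right 0. (t, Y t) \<in> S \<and> (t, Y t) \<noteq> (0, 0)"
    using S eventually_at_right_less[of 0] by eventually_elim auto
  ultimately show ?thesis by (auto simp: filterlim_at)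
qed

text \<open>
  The curve \<open>X\<close> bounds \<open>S\<close>, and \<open>V\<close> need not be differentiable on it. The estimate is therefore made
  on the nearby curves \<open>X(t) + \<sigma> \<epsilon> t\<close>, which start at the origin too and run inside \<open>S\<close> on the side
  given by the sign of \<open>\<sigma>\<close>, and it is carried over to \<open>X\<close> by letting \<open>\<epsilon> \<rightarrow> 0\<close> at fixed \<open>t\<close>.
\<close>

lemma difference_quotient_along_boundary_curve:
  fixes V :: "real \<times> real \<Rightarrow> real^6"
  assumes "0 < T"
    and cont: "continuous_on (box_at_origin T r) V"
    and X0: "X 0 = 0" and Xr: "\<And>t. t \<in> {0..<T} \<Longrightarrow> \<bar>X t\<bar> < r"
    and derX: "\<And>t. t \<in> {0..<T} \<Longrightarrow> (X has_real_derivative X' t) (at t within {0..<T})"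
    and contX': "continuous_on {0..<T} X'"
    and S: "S \<subseteq> box_at_origin T r" and diff: "\<And>p. p \<in> S \<Longrightarrow> V differentiable (at p)"
    and A: "(pdt V \<longlongrightarrow> A) (at (0, 0) within S)" and B: "(pdx V \<longlongrightarrow> B) (at (0, 0) within S)"
    and "\<bar>\<sigma>\<bar> \<le> 1" and "0 < \<epsilon>0"
    and path: "\<forall>\<^sub>F t in at_right 0. \<forall>\<epsilon>. 0 < \<epsilon> \<and> \<epsilon> < \<epsilon>0 \<longrightarrow> (t, X t + \<sigma> * \<epsilon> * t) \<in> S"
  shows "((\<lambda>t. (V (t, X t) - V (0, 0)) /\<^sub>R t) \<longlongrightarrow> A + X' 0 *\<^sub>R B) (at_right 0)"
proof -
  have contX: "continuous_on {0..<T} X"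
    using derX by (rule DERIV_continuous_on)
  have at0: "at_right 0 = at 0 within {0..<T}"
    by (rule at_within_nhd[of _ "{..<T}"]) (use \<open>0 < T\<close> in auto)
  have tX: "(X \<longlongrightarrow> 0) (at_right 0)" and tX': "(X' \<longlongrightarrow> X' 0) (at_right 0)"
    using contX[unfolded continuous_on_def, rule_format, of 0]
      contX'[unfolded continuous_on_def, rule_format, of 0] X0 \<open>0 < T\<close> by (simp_all add: at0)
  \<comment> \<open>\<open>M\<close> bounds the slope \<open>X' + \<sigma> \<epsilon>\<close> near \<open>0\<close>: one unit for the variation of \<open>X'\<close>, one for \<open>\<sigma> \<epsilon>\<close>\<close>
  define M where "M = \<bar>X' 0\<bar> + 2"
  have small: "\<forall>\<^sub>F t in at_right 0. norm (V (t, X t) - V (0, 0) - t *\<^sub>R A - X t *\<^sub>R B) \<le> (e + M * e) * t"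
    if "0 < e" for e
  proof -
    have "\<forall>\<^sub>F p in at (0, 0) within S. norm (pdt V p - A) \<le> e \<and> norm (pdx V p - B) \<le> e"
      using tendstoD[OF A \<open>0 < e\<close>] tendstoD[OF B \<open>0 < e\<close>] by eventually_elim (auto simp: dist_norm)
    then obtain d where "0 < d" and d: "\<And>p. p \<in> S \<Longrightarrow> p \<noteq> (0, 0) \<Longrightarrow> dist p (0, 0) < d \<Longrightarrow>
        norm (pdt V p - A) \<le> e \<and> norm (pdx V p - B) \<le> e"
      unfolding eventually_at by blast
    have "\<forall>\<^sub>F t in at_right 0. t < d / 3 \<and> t < T \<and> \<bar>X t\<bar> < d / 3 \<and> \<bar>X' t\<bar> \<le> M - 1 \<and>
        (\<forall>\<epsilon>. 0 < \<epsilon> \<and> \<epsilon> < \<epsilon>0 \<longrightarrow> (t, X t + \<sigma> * \<epsilon> * t) \<in> S)"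
    proof (intro eventually_conj path)
      show "\<forall>\<^sub>F t in at_right 0. t < d / 3" "\<forall>\<^sub>F t in at_right 0. t < T"
        using \<open>0 < d\<close> \<open>0 < T\<close> by (simp_all only: order_tendstoD(2)[OF tendsto_ident_at] divide_pos_pos zero_less_numeral)
      show "\<forall>\<^sub>F t in at_right 0. \<bar>X t\<bar> < d / 3"
        using tendstoD[OF tX, of "d / 3"] \<open>0 < d\<close> by (simp add: dist_norm)
      show "\<forall>\<^sub>F t in at_right 0. \<bar>X' t\<bar> \<le> M - 1"
        using tendstoD[OF tX', of 1] by (auto simp: dist_norm M_def elim!: eventually_mono)
    qed
    then obtain b where "0 < b" and b: "\<And>t. 0 < t \<Longrightarrow> t < b \<Longrightarrow> t < d / 3 \<and> t < T \<and> \<bar>X t\<bar> < d / 3 \<and>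
        \<bar>X' t\<bar> \<le> M - 1 \<and> (\<forall>\<epsilon>. 0 < \<epsilon> \<and> \<epsilon> < \<epsilon>0 \<longrightarrow> (t, X t + \<sigma> * \<epsilon> * t) \<in> S)"
      unfolding eventually_at_right_field by blast
    have "norm (V (t, X t) - V (0, 0) - t *\<^sub>R A - X t *\<^sub>R B) \<le> (e + M * e) * t"
      if t: "0 < t" "t < b" for t
    proof -
      have bound: "norm (V (t, X t + \<sigma> * \<epsilon> * t) - V (0, 0) - t *\<^sub>R A - (X t + \<sigma> * \<epsilon> * t) *\<^sub>R B)
          \<le> (e + M * e) * t" if \<epsilon>: "0 < \<epsilon>" "\<epsilon> < \<epsilon>0" "\<epsilon> < 1" for \<epsilon>
      proof -
        define Y where "Y \<tau> = X \<tau> + \<sigma> * \<epsilon> * \<tau>" for \<tau>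
        have \<sigma>\<epsilon>: "\<bar>\<sigma> * \<epsilon>\<bar> \<le> 1"
          using \<open>\<bar>\<sigma>\<bar> \<le> 1\<close> \<epsilon> mult_mono[of "\<bar>\<sigma>\<bar>" 1 \<epsilon> 1] by (simp add: abs_mult)
        have inS: "(\<tau>, Y \<tau>) \<in> S" if "0 < \<tau>" "\<tau> < b" for \<tau>
          using b[OF that] \<epsilon> unfolding Y_def by auto
        have near: "norm (pdt V (\<tau>, Y \<tau>) - A) \<le> e \<and> norm (pdx V (\<tau>, Y \<tau>) - B) \<le> e"
          if "0 < \<tau>" "\<tau> < t" for \<tau>
        proof (rule d)
          have \<tau>b: "\<tau> < b" using that t by simp
          show "(\<tau>, Y \<tau>) \<in> S" using inS that \<tau>b by simp
          show "(\<tau>, Y \<tau>) \<noteq> (0, 0)" using that by simp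
          have "\<bar>\<sigma> * \<epsilon> * \<tau>\<bar> \<le> 1 * \<bar>\<tau>\<bar>"
            unfolding abs_mult[of "\<sigma> * \<epsilon>"] by (intro mult_right_mono \<sigma>\<epsilon>) auto
          then have "\<bar>\<tau>\<bar> + \<bar>Y \<tau>\<bar> < d"
            using b[OF that(1) \<tau>b] that unfolding Y_def by linarith
          then show "dist (\<tau>, Y \<tau>) (0, 0) < d"
            using dist_origin_le[of \<tau> "Y \<tau>"] by linarith
        qed
        have contY: "continuous_on {0..t} Y"
          unfolding Y_def using b[OF t] by (intro continuous_intros continuous_on_subset[OF contX]) auto
        have "norm (V (t, Y t) - V (0, Y 0) - t *\<^sub>R A - (Y t - Y 0) *\<^sub>R B) \<le> (e + M * e) * t"
        proof (rule norm_increment_along_curve_le[where Y'="\<lambda>\<tau>. X' \<tau> + \<sigma> * \<epsilon>"])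
          have "0 < r" using Xr[of 0] \<open>0 < T\<close> by auto
          have "(\<tau>, Y \<tau>) \<in> box_at_origin T r" if "\<tau> \<in> {0..t}" for \<tau>
          proof (cases "\<tau> = 0")
            case True
            then show ?thesis using X0 \<open>0 < r\<close> \<open>0 < T\<close> by (auto simp: Y_def box_at_origin_def)
          next
            case False
            then show ?thesis using inS[of \<tau>] that t S by auto
          qed
          then show "continuous_on {0..t} (\<lambda>\<tau>. V (\<tau>, Y \<tau>))"
            by (intro continuous_on_compose2[OF cont] continuous_intros contY) auto
          fix \<tau> assume \<tau>: "0 < \<tau>" "\<tau> < t"
          then show "V differentiable (at (\<tau>, Y \<tau>))" using inS diff t by simp
          have "\<tau> < T" using b[of \<tau>] \<tau> t by simp
          then have "at \<tau> within {0..<T} = at \<tau>"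
            by (intro at_within_interior) (use \<tau> in auto)
          then have "(X has_real_derivative X' \<tau>) (at \<tau>)"
            using derX[of \<tau>] \<tau> \<open>\<tau> < T\<close> by simp
          then show "(Y has_real_derivative X' \<tau> + \<sigma> * \<epsilon>) (at \<tau>)"
            unfolding Y_def by (auto intro!: derivative_eq_intros)
          show "\<bar>X' \<tau> + \<sigma> * \<epsilon>\<bar> \<le> M" using \<sigma>\<epsilon> b[of \<tau>] \<tau> t by auto
        qed (use near contY t in auto)
        then show ?thesis by (simp add: Y_def X0)
      qed
      show ?thesis
      proof (rule tendsto_upperbound)
        have "(t, X t) \<in> box_at_origin T r" using Xr[of t] b[OF t] t by (auto simp: box_at_origin_def)
        moreover have "\<forall>\<^sub>F \<epsilon> in at_right 0. (t, X t + \<sigma> * \<epsilon> * t) \<in> box_at_origin T r"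
          using eventually_at_right_less[of 0] order_tendstoD(2)[OF tendsto_ident_at \<open>0 < \<epsilon>0\<close>]
          by eventually_elim (use b[OF t] S in auto)
        moreover have "((\<lambda>\<epsilon>. (t, X t + \<sigma> * \<epsilon> * t)) \<longlongrightarrow> (t, X t)) (at_right 0)"
          by (auto intro!: tendsto_eq_intros)
        ultimately have "((\<lambda>\<epsilon>. V (t, X t + \<sigma> * \<epsilon> * t)) \<longlongrightarrow> V (t, X t)) (at_right 0)"
          by (intro continuous_on_tendsto_compose[OF cont])
        then show "((\<lambda>\<epsilon>. norm (V (t, X t + \<sigma> * \<epsilon> * t) - V (0, 0) - t *\<^sub>R A - (X t + \<sigma> * \<epsilon> * t) *\<^sub>R B))
            \<longlongrightarrow> norm (V (t, X t) - V (0, 0) - t *\<^sub>R A - X t *\<^sub>R B)) (at_right 0)"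
          by (auto intro!: tendsto_eq_intros)
        show "\<forall>\<^sub>F \<epsilon> in at_right 0.
            norm (V (t, X t + \<sigma> * \<epsilon> * t) - V (0, 0) - t *\<^sub>R A - (X t + \<sigma> * \<epsilon> * t) *\<^sub>R B) \<le> (e + M * e) * t"
          using eventually_at_right_less[of 0] order_tendstoD(2)[OF tendsto_ident_at \<open>0 < \<epsilon>0\<close>]
            order_tendstoD(2)[OF tendsto_ident_at zero_less_one]
          by eventually_elim (rule bound)
      qed simp
    qed
    then show ?thesis unfolding eventually_at_right_field using \<open>0 < b\<close> by blast
  qed
  have "((\<lambda>t. (V (t, X t) - V (0, 0) - t *\<^sub>R A - X t *\<^sub>R B) /\<^sub>R t) \<longlongrightarrow> 0) (at_right 0)"
  proof (rule tendstoI)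
    fix \<eta> :: real assume "0 < \<eta>"
    define e where "e = \<eta> / (2 * (1 + M))"
    have "0 < M" by (simp add: M_def)
    then have "0 < e" using \<open>0 < \<eta>\<close> by (simp add: e_def)
    have "e + M * e = (1 + M) * e" by (simp add: algebra_simps)
    also have "\<dots> = \<eta> / 2" using \<open>0 < M\<close> unfolding e_def by (simp add: divide_eq_eq)
    finally have eq: "e + M * e < \<eta>" using \<open>0 < \<eta>\<close> by simp
    show "\<forall>\<^sub>F t in at_right 0. dist ((V (t, X t) - V (0, 0) - t *\<^sub>R A - X t *\<^sub>R B) /\<^sub>R t) 0 < \<eta>"
      using small[OF \<open>0 < e\<close>] eventually_at_right_less[of 0]
    proof eventually_elim
      case (elim t)
      then have "norm (V (t, X t) - V (0, 0) - t *\<^sub>R A - X t *\<^sub>R B) / t \<le> e + M * e"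
        by (simp add: divide_le_eq)
      then show ?case using elim eq by (simp add: divide_inverse mult.commute)
    qed
  qed
  moreover have "((\<lambda>t. X t / t) \<longlongrightarrow> X' 0) (at_right 0)"
    using derX[of 0] \<open>0 < T\<close> X0 by (simp add: has_field_derivative_iff flip: at0)
  ultimately have "((\<lambda>t. (V (t, X t) - V (0, 0) - t *\<^sub>R A - X t *\<^sub>R B) /\<^sub>R t + A + (X t / t) *\<^sub>R B)
      \<longlongrightarrow> 0 + A + X' 0 *\<^sub>R B) (at_right 0)"
    by (intro tendsto_intros)
  moreover have "\<forall>\<^sub>F t in at_right 0.
      (V (t, X t) - V (0, 0) - t *\<^sub>R A - X t *\<^sub>R B) /\<^sub>R t + A + (X t / t) *\<^sub>R B = (V (t, X t) - V (0, 0)) /\<^sub>R t"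
    using eventually_at_right_less[of 0]
    by eventually_elim (simp add: scaleR_diff_right divide_inverse mult.commute)
  ultimately show ?thesis by (simp add: tendsto_cong)
qed

text \<open>
  On a segment \<open>{t} \<times> {a..b}\<close> inside \<open>S\<close> and near the origin, the increment of \<open>V\<close> differs from
  \<open>(b - a) B\<close> by at most \<open>e (b - a)\<close>. Keeping \<open>a\<close> and \<open>b\<close> fixed and letting \<open>t \<rightarrow> 0\<close> turns this into
  a statement about the initial data, since \<open>V\<close> is continuous up to \<open>t = 0\<close>.
\<close>

lemma limit_slope_eq_initial_slope:
  fixes V :: "real \<times> real \<Rightarrow> real^6"
  assumes "0 < T"
    and cont: "continuous_on (box_at_origin T r) V"
    and S: "S \<subseteq> box_at_origin T r" and diff: "\<And>p. p \<in> S \<Longrightarrow> V differentiable (at p)"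
    and B: "(pdx V \<longlongrightarrow> B) (at (0, 0) within S)"
    and segments: "\<And>d. 0 < d \<Longrightarrow> \<exists>a b. a < b \<and> \<bar>a\<bar> < d \<and> \<bar>b\<bar> < d \<and> {a..b} \<subseteq> {-r<..<r} \<and>
        V (0, a) = v + a *\<^sub>R v' \<and> V (0, b) = v + b *\<^sub>R v' \<and> (\<forall>\<^sub>F t in at_right 0. {t} \<times> {a..b} \<subseteq> S)"
  shows "B = v'"
proof -
  have "norm (v' - B) \<le> e" if "0 < e" for e
  proof -
    obtain d where "0 < d" and d: "\<And>p. p \<in> S \<Longrightarrow> p \<noteq> (0, 0) \<Longrightarrow> dist p (0, 0) < d \<Longrightarrow>
        dist (pdx V p) B < e"
      using tendstoD[OF B \<open>0 < e\<close>] unfolding eventually_at by blast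
    obtain a b where ab: "a < b" "\<bar>a\<bar> < d / 2" "\<bar>b\<bar> < d / 2" "{a..b} \<subseteq> {-r<..<r}"
        "V (0, a) = v + a *\<^sub>R v'" "V (0, b) = v + b *\<^sub>R v'"
        and inS: "\<forall>\<^sub>F t in at_right 0. {t} \<times> {a..b} \<subseteq> S"
      using segments[of "d / 2"] \<open>0 < d\<close> by auto
    have lim: "((\<lambda>t. V (t, x)) \<longlongrightarrow> V (0, x)) (at_right 0)" if "x \<in> {a..b}" for x
    proof -
      have "continuous_on {0..<T} (\<lambda>t. V (t, x))"
        by (intro continuous_on_compose2[OF cont] continuous_intros) (use that ab(4) in \<open>auto simp: box_at_origin_def\<close>)
      moreover have "at_right 0 = at 0 within {0..<T}"
        by (rule at_within_nhd[of _ "{..<T}"]) (use \<open>0 < T\<close> in auto)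
      ultimately show ?thesis using \<open>0 < T\<close> by (simp add: continuous_on_def)
    qed
    have "norm (V (0, b) - V (0, a) - (b - a) *\<^sub>R B) \<le> e * (b - a)"
    proof (rule tendsto_upperbound)
      show "((\<lambda>t. norm (V (t, b) - V (t, a) - (b - a) *\<^sub>R B)) \<longlongrightarrow>
          norm (V (0, b) - V (0, a) - (b - a) *\<^sub>R B)) (at_right 0)"
        using ab(1) by (intro tendsto_intros lim) auto
      have "\<forall>\<^sub>F t in at_right 0. t < d / 2"
        by (rule order_tendstoD(2)[OF tendsto_ident_at]) (use \<open>0 < d\<close> in simp)
      with inS eventually_at_right_less[of 0]
      show "\<forall>\<^sub>F t in at_right 0. norm (V (t, b) - V (t, a) - (b - a) *\<^sub>R B) \<le> e * (b - a)"
      proof eventually_elim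
        case (elim t)
        let ?g = "\<lambda>x. V (t, x) - x *\<^sub>R B"
        have der: "(?g has_vector_derivative pdx V (t, x) - B) (at x)" if "x \<in> {a..b}" for x
        proof -
          have "(t, x) \<in> S" using elim that by blast
          then have "V differentiable (at (t, x))" by (rule diff)
          then have "(?g has_vector_derivative pdx V (t, x) - 1 *\<^sub>R B) (at x)"
            by (intro has_vector_derivative_diff vector_derivative_in_space) (auto intro!: derivative_eq_intros)
          then show ?thesis by simp
        qed
        have "norm (?g b - ?g a) \<le> e * b - e * a"
        proof (rule differentiable_bound_general[where f'="\<lambda>x. pdx V (t, x) - B" and \<phi>'="\<lambda>_. e"])
          show "continuous_on {a..b} ?g"
            using der by (intro continuous_at_imp_continuous_on) (blast intro: has_vector_derivative_continuous)
          show "continuous_on {a..b} (\<lambda>x. e * x)" by (intro continuous_intros)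
          fix x assume x: "a < x" "x < b"
          then show "(?g has_vector_derivative pdx V (t, x) - B) (at x)" by (intro der) auto
          show "((\<lambda>x. e * x) has_vector_derivative e) (at x)"
            by (auto intro!: derivative_eq_intros simp flip: has_real_derivative_iff_has_vector_derivative)
          have "dist (t, x) (0, 0) < d"
            using dist_origin_le[of t x] x ab elim by auto
          moreover have "(t, x) \<in> S" using elim x by auto
          ultimately have "dist (pdx V (t, x)) B < e" using d[of "(t, x)"] elim by auto
          then show "norm (pdx V (t, x) - B) \<le> e" by (simp add: dist_norm)
        qed (fact ab(1))
        then show ?case by (simp add: algebra_simps)
      qed
    qed simp
    moreover have "V (0, b) - V (0, a) - (b - a) *\<^sub>R B = (b - a) *\<^sub>R (v' - B)"
      by (simp add: ab algebra_simps)
    ultimately show ?thesis using ab(1) by (simp add: mult.commute)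
  qed
  then have "norm (v' - B) \<le> 0" by (rule field_le_epsilon[of _ 0, simplified])
  then show ?thesis by simp
qed


section \<open>The balance laws and their jumps across a characteristic\<close>

text \<open>
  The system as an algebraic relation between a state \<open>v\<close>, an \<open>x\<close>-derivative \<open>b\<close>, a material
  derivative \<open>d\<close> and a slope \<open>g\<close> of the potential, so that it makes sense for limits at the origin,
  which are not derivatives of \<open>V\<close> there.
\<close>

definition ten_moment_balance :: "real \<Rightarrow> real^6 \<Rightarrow> real^6 \<Rightarrow> real^6 \<Rightarrow> bool" where
  "ten_moment_balance g v b d \<longleftrightarrow>
      rho d + rho v * u1 b = 0 \<and>
      u1 d + 1 / rho v * p11 b = - (1/2) * g \<and>
      u2 d + 1 / rho v * p12 b = 0 \<and>
      p11 d + 3 * p11 v * u1 b = 0 \<and>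
      p12 d + 2 * p12 v * u1 b + p11 v * u2 b = 0 \<and>
      p22 d + p22 v * u1 b + 2 * p12 v * u2 b = 0"

lemma ten_moment_at_iff_balance:
  "ten_moment_at W V p \<longleftrightarrow> ten_moment_balance (deriv W (snd p)) (V p) (pdx V p) (material_deriv V p)"
  by (simp add: ten_moment_at_def ten_moment_balance_def Let_def)

lemma ten_moment_balance_limit:
  assumes "F \<noteq> bot" and "rho v0 \<noteq> 0"
    and g: "(g \<longlongrightarrow> g0) F" and v: "(v \<longlongrightarrow> v0) F" and b: "(b \<longlongrightarrow> b0) F" and d: "(d \<longlongrightarrow> d0) F"
    and bal: "\<forall>\<^sub>F p in F. ten_moment_balance (g p) (v p) (b p) (d p)"
  shows "ten_moment_balance g0 v0 b0 d0"
proof -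
  note nth = tendsto_vec_nth[OF v] tendsto_vec_nth[OF b] tendsto_vec_nth[OF d]
  have eq: "l = l'" if "(f \<longlongrightarrow> l) F" "(f' \<longlongrightarrow> l') F"
    "\<And>p. ten_moment_balance (g p) (v p) (b p) (d p) \<Longrightarrow> f p = f' p" for f f' :: "_ \<Rightarrow> real" and l l'
  proof -
    have "\<forall>\<^sub>F p in F. f p = f' p" using bal by eventually_elim (rule that(3))
    then show ?thesis using that(1,2) \<open>F \<noteq> bot\<close> by (metis tendsto_cong tendsto_unique)
  qed
  show ?thesis
    unfolding ten_moment_balance_def
    apply (intro conjI)
    subgoal by (rule eq[where f="\<lambda>p. rho (d p) + rho (v p) * u1 (b p)" and f'="\<lambda>_. 0"])
      (auto intro!: tendsto_intros nth simp: ten_moment_balance_def)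
    subgoal by (rule eq[where f="\<lambda>p. u1 (d p) + 1 / rho (v p) * p11 (b p)" and f'="\<lambda>p. - (1/2) * g p"])
      (use \<open>rho v0 \<noteq> 0\<close> in \<open>auto intro!: tendsto_intros nth g simp: ten_moment_balance_def\<close>)
    subgoal by (rule eq[where f="\<lambda>p. u2 (d p) + 1 / rho (v p) * p12 (b p)" and f'="\<lambda>_. 0"])
      (use \<open>rho v0 \<noteq> 0\<close> in \<open>auto intro!: tendsto_intros nth simp: ten_moment_balance_def\<close>)
    subgoal by (rule eq[where f="\<lambda>p. p11 (d p) + 3 * p11 (v p) * u1 (b p)" and f'="\<lambda>_. 0"])
      (auto intro!: tendsto_intros nth simp: ten_moment_balance_def)
    subgoal by (rule eq[where f="\<lambda>p. p12 (d p) + 2 * p12 (v p) * u1 (b p) + p11 (v p) * u2 (b p)" and f'="\<lambda>_. 0"])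
      (auto intro!: tendsto_intros nth simp: ten_moment_balance_def)
    subgoal by (rule eq[where f="\<lambda>p. p22 (d p) + p22 (v p) * u1 (b p) + 2 * p12 (v p) * u2 (b p)" and f'="\<lambda>_. 0"])
      (auto intro!: tendsto_intros nth simp: ten_moment_balance_def)
    done
qed

text \<open>
  The jumps \<open>\<delta>u\<close>, \<open>\<delta>p\<close> of the \<open>u\<^sub>1\<close>- and \<open>p\<^sub>1\<^sub>1\<close>-slopes satisfy \<open>\<delta>p = l \<rho> \<delta>u\<close> (momentum) and
  \<open>l \<delta>p = 3 p\<^sub>1\<^sub>1 \<delta>u\<close> (pressure). This closed subsystem has a nonzero solution only for
  \<open>l\<^sup>2 \<rho> = 3 p\<^sub>1\<^sub>1\<close>. The source cancels in the jumps.
\<close>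

lemma slopes_continuous_across_nonacoustic_wave:
  assumes bal: "ten_moment_balance g v b d" "ten_moment_balance g v b' d'"
    and jump: "d + l *\<^sub>R b = d' + l *\<^sub>R b'"
    and "rho v \<noteq> 0" and nonacoustic: "l\<^sup>2 * rho v \<noteq> 3 * p11 v"
  shows "u1 b = u1 b'" and "p11 b = p11 b'" and "p11 d = p11 d'"
proof -
  have comp: "d $ i + l * b $ i = d' $ i + l * b' $ i" for i
    using arg_cong[OF jump, of "\<lambda>z. z $ i"] by simp
  define \<delta>u where "\<delta>u = u1 b - u1 b'"
  define \<delta>p where "\<delta>p = p11 b - p11 b'"
  have "rho v * (u1 d - u1 d') = - \<delta>p"
    using bal \<open>rho v \<noteq> 0\<close> unfolding ten_moment_balance_def \<delta>p_def by (simp add: field_simps)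
  moreover have "u1 d - u1 d' = - l * \<delta>u" using comp[of 2] by (simp add: \<delta>u_def algebra_simps)
  ultimately have p: "\<delta>p = rho v * l * \<delta>u" by (simp add: algebra_simps)
  have "p11 d - p11 d' = - 3 * p11 v * \<delta>u"
    using bal unfolding ten_moment_balance_def \<delta>u_def by (simp add: algebra_simps)
  moreover have "p11 d - p11 d' = - l * \<delta>p" using comp[of 4] by (simp add: \<delta>p_def algebra_simps)
  ultimately have "(l\<^sup>2 * rho v - 3 * p11 v) * \<delta>u = 0"
    by (simp add: p power2_eq_square algebra_simps)
  then have "\<delta>u = 0" using nonacoustic by simp
  then show u: "u1 b = u1 b'" and "p11 b = p11 b'" using p by (simp_all add: \<delta>u_def \<delta>p_def)
  with comp[of 4] show "p11 d = p11 d'" by simp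
qed

text \<open>
  Here \<open>b0, d0\<close> belong to the known outer side. The equations for \<open>u\<^sub>2\<close> and \<open>p\<^sub>1\<^sub>2\<close> give
  \<open>\<delta>q = l \<rho> \<delta>w\<close> and \<open>l \<delta>q = 2 p\<^sub>1\<^sub>2 \<delta>u + p\<^sub>1\<^sub>1 \<delta>w\<close> for the jumps \<open>\<delta>u, \<delta>w, \<delta>q\<close> of the slopes of
  \<open>u\<^sub>1, u\<^sub>2, p\<^sub>1\<^sub>2\<close>; with \<open>l\<^sup>2 \<rho> = 3 p\<^sub>1\<^sub>1\<close> this becomes \<open>p\<^sub>1\<^sub>1 \<delta>w = p\<^sub>1\<^sub>2 \<delta>u\<close>, which expresses all
  jumps by that of the \<open>u\<^sub>1\<close>-slope, that is, by \<open>D p\<^sub>1\<^sub>1\<close>.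
\<close>

lemma relations_across_acoustic_wave:
  assumes bal: "ten_moment_balance g v b0 d0" "ten_moment_balance g v b d"
    and jump: "d0 + l *\<^sub>R b0 = d + l *\<^sub>R b"
    and pos: "rho v > 0" "p11 v > 0" and acoustic: "l\<^sup>2 * rho v = 3 * p11 v"
  shows "p11 d + l * p11 b = - 3 * p11 v * u1 b0 + l * p11 b0"
    and "p12 d = p12 v / p11 v * p11 d + p12 v * u1 b0 - p11 v * u2 b0"
    and "u2 d = - p12 b0 / rho v + l * p12 v / p11 v * u1 b0 + p12 v * l / (3 * (p11 v)\<^sup>2) * p11 d"
    and "l * p22 b = - p22 v * u1 b0 - 2 * p12 v * u2 b0 + l * p22 b0 - p22 d"
proof -
  have comp: "d0 $ i + l * b0 $ i = d $ i + l * b $ i" for i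
    using arg_cong[OF jump, of "\<lambda>z. z $ i"] by simp
  note laws = bal[unfolded ten_moment_balance_def]
  have r: "rho v \<noteq> 0" "p11 v \<noteq> 0" using pos by auto
  show "p11 d + l * p11 b = - 3 * p11 v * u1 b0 + l * p11 b0"
    using comp[of 4] laws by simp
  show "l * p22 b = - p22 v * u1 b0 - 2 * p12 v * u2 b0 + l * p22 b0 - p22 d"
    using comp[of 6] laws by simp
  define \<delta>u where "\<delta>u = u1 b - u1 b0"
  define \<delta>w where "\<delta>w = u2 b - u2 b0"
  define \<delta>q where "\<delta>q = p12 b - p12 b0"
  have "rho v * (u2 d - u2 d0) = - \<delta>q"
    using laws r unfolding \<delta>q_def by (simp add: field_simps)
  moreover have w: "u2 d - u2 d0 = - l * \<delta>w" using comp[of 3] by (simp add: \<delta>w_def algebra_simps)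
  ultimately have q: "\<delta>q = rho v * l * \<delta>w" by (simp add: algebra_simps)
  have "p12 d - p12 d0 = - 2 * p12 v * \<delta>u - p11 v * \<delta>w"
    using laws unfolding \<delta>u_def \<delta>w_def by (simp add: algebra_simps)
  moreover have "p12 d - p12 d0 = - l * \<delta>q" using comp[of 5] by (simp add: \<delta>q_def algebra_simps)
  ultimately have "(l\<^sup>2 * rho v) * \<delta>w = 2 * p12 v * \<delta>u + p11 v * \<delta>w"
    by (simp add: q power2_eq_square algebra_simps)
  then have uw: "p11 v * \<delta>w = p12 v * \<delta>u" unfolding acoustic by (simp add: algebra_simps)
  have D: "p11 d = - 3 * p11 v * u1 b" using laws by simp
  have "p12 d = - 2 * p12 v * u1 b - p11 v * u2 b0 - p11 v * \<delta>w"
    using laws by (simp add: \<delta>w_def algebra_simps)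
  then show "p12 d = p12 v / p11 v * p11 d + p12 v * u1 b0 - p11 v * u2 b0"
    using r unfolding uw D by (simp add: \<delta>u_def algebra_simps)
  have "u2 d = - p12 b0 / rho v - l * \<delta>w" using laws w by simp
  moreover have "\<delta>w = p12 v * \<delta>u / p11 v" using uw r by (simp add: field_simps)
  ultimately have "u2 d = - p12 b0 / rho v - l * (p12 v * \<delta>u / p11 v)" by simp
  also have "l * (p12 v * \<delta>u / p11 v) =
      - (l * p12 v / p11 v * u1 b0) - p12 v * l / (3 * (p11 v)\<^sup>2) * p11 d"
    using r unfolding D by (simp add: \<delta>u_def field_simps power2_eq_square)
  finally show "u2 d = - p12 b0 / rho v + l * p12 v / p11 v * u1 b0 + p12 v * l / (3 * (p11 v)\<^sup>2) * p11 d"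
    by simp
qed

section \<open>The wave fan\<close>

fun left_region :: "wave \<Rightarrow> region" where
  "left_region Wave1 = Outer L"
| "left_region Wave2 = Star L"
| "left_region Contact = StarStar L"
| "left_region Wave5 = StarStar R"
| "left_region Wave6 = Star R"

fun right_region :: "wave \<Rightarrow> region" where
  "right_region Wave1 = Star L"
| "right_region Wave2 = StarStar L"
| "right_region Contact = StarStar R"
| "right_region Wave5 = Star R"
| "right_region Wave6 = Outer R"

lemma region_adjacent_to_wave: "\<exists>w. Q = left_region w \<or> Q = right_region w"
proof (cases Q)
  case (Outer K) then show ?thesis by (cases K) (metis left_region.simps right_region.simps)+
next
  case (Star K) then show ?thesis by (cases K) (metis left_region.simps right_region.simps)+
next
  case (StarStar K) then show ?thesis by (cases K) (metis left_region.simps right_region.simps)+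
qed

lemma eventually_curves_separate:
  fixes Y Z :: "real \<Rightarrow> real"
  assumes "0 < T" "Y 0 = 0" "Z 0 = 0" "y < z"
    and Y: "(Y has_real_derivative y) (at 0 within {0..<T})"
    and Z: "(Z has_real_derivative z) (at 0 within {0..<T})"
  shows "\<forall>\<^sub>F t in at_right 0. Y t + (z - y) / 2 * t < Z t"
proof -
  have at0: "at_right 0 = at 0 within {0..<T}"
    by (rule at_within_nhd[of _ "{..<T}"]) (use \<open>0 < T\<close> in auto)
  have "((\<lambda>t. Z t / t - Y t / t) \<longlongrightarrow> z - y) (at_right 0)"
    using Y Z assms by (intro tendsto_diff) (simp_all add: has_field_derivative_iff flip: at0)
  then have "\<forall>\<^sub>F t in at_right 0. (z - y) / 2 < Z t / t - Y t / t"
    by (rule order_tendstoD(1)) (use \<open>y < z\<close> in simp)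
  then show ?thesis using eventually_at_right_less[of 0]
    by eventually_elim (simp add: field_simps)
qed

locale acoustic_GRP =
  fixes W :: "real \<Rightarrow> real"
    and V0 V0' :: "side \<Rightarrow> real^6"
    and Vs :: "real^6"
    and T r :: real
    and X :: "wave \<Rightarrow> real \<Rightarrow> real"
    and V :: "real \<times> real \<Rightarrow> real^6"
  assumes sol: "acoustic_GRP_solution W V0 V0' Vs T r X V"
begin

abbreviation Reg :: "region \<Rightarrow> (real \<times> real) set" where "Reg \<equiv> region_set T r X"
abbreviation Vt :: "region \<Rightarrow> real^6" where "Vt Q \<equiv> origin_limit (Reg Q) (pdt V)"
abbreviation Vx :: "region \<Rightarrow> real^6" where "Vx Q \<equiv> origin_limit (Reg Q) (pdx V)"
abbreviation DV :: "region \<Rightarrow> real^6" where "DV Q \<equiv> origin_limit (Reg Q) (material_deriv V)"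

lemma W_C1: "W C1_differentiable_on UNIV"
  and V0: "V0 K = Vs"
  and T_pos: "0 < T" and r_pos: "0 < r"
  and continuous_V: "continuous_on (box_at_origin T r) V"
  and admissible_V: "p \<in> box_at_origin T r \<Longrightarrow> admissible (V p)"
  and initial_L: "- r < x \<Longrightarrow> x < 0 \<Longrightarrow> V (0, x) = Vs + x *\<^sub>R V0' L"
  and initial_R: "0 < x \<Longrightarrow> x < r \<Longrightarrow> V (0, x) = Vs + x *\<^sub>R V0' R"
  and X_0: "X w 0 = 0"
  and X_bound: "t \<in> {0..<T} \<Longrightarrow> \<bar>X w t\<bar> < r"
  and X_deriv: "t \<in> {0..<T} \<Longrightarrow>
      (X w has_real_derivative wave_speed w (V (t, X w t))) (at t within {0..<T})"
  and smooth: "smooth_with_limits V (Reg Q)"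
  and ten_moment: "p \<in> Reg Q \<Longrightarrow> ten_moment_at W V p"
proof -
  note * = sol[unfolded acoustic_GRP_solution_def characteristic_from_origin_def]
  have V0': "V0 L = Vs" "V0 R = Vs" using * by blast+
  then show V0: "V0 K = Vs" by (cases K) simp_all
  show "W C1_differentiable_on UNIV" "0 < T" "0 < r" "continuous_on (box_at_origin T r) V"
    "p \<in> box_at_origin T r \<Longrightarrow> admissible (V p)" "X w 0 = 0"
    "t \<in> {0..<T} \<Longrightarrow> \<bar>X w t\<bar> < r" "smooth_with_limits V (Reg Q)" "p \<in> Reg Q \<Longrightarrow> ten_moment_at W V p"
    using * by blast+
  show "t \<in> {0..<T} \<Longrightarrow>
      (X w has_real_derivative wave_speed w (V (t, X w t))) (at t within {0..<T})"
    using * by blast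
  have "- r < x \<Longrightarrow> x < 0 \<Longrightarrow> V (0, x) = V0 L + x *\<^sub>R V0' L"
    and "0 < x \<Longrightarrow> x < r \<Longrightarrow> V (0, x) = V0 R + x *\<^sub>R V0' R"
    using * by blast+
  then show "- r < x \<Longrightarrow> x < 0 \<Longrightarrow> V (0, x) = Vs + x *\<^sub>R V0' L"
    and "0 < x \<Longrightarrow> x < r \<Longrightarrow> V (0, x) = Vs + x *\<^sub>R V0' R"
    unfolding V0' by blast+
qed

lemma X_between: "t \<in> {0..<T} \<Longrightarrow> - r < X w t" "t \<in> {0..<T} \<Longrightarrow> X w t < r"
  using X_bound[of t w] by linarith+

lemma at_right_0: "at_right 0 = at 0 within {0..<T}"
  by (rule at_within_nhd[of _ "{..<T}"]) (use T_pos in auto)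

lemma continuous_X: "continuous_on {0..<T} (X w)"
  using X_deriv by (rule DERIV_continuous_on)

lemma X_tendsto_0: "(X w \<longlongrightarrow> 0) (at_right 0)"
  using continuous_X[unfolded continuous_on_def, rule_format, of 0 w] T_pos
  by (simp add: at_right_0 X_0)

lemma eventually_small: "0 < d \<Longrightarrow> \<forall>\<^sub>F t in at_right 0. t < d" for d :: real
  by (rule order_tendstoD(2)[OF tendsto_ident_at])

lemma X_near_0: "0 < d \<Longrightarrow> \<forall>\<^sub>F t in at_right 0. \<bar>X w t\<bar> < d"
  using tendstoD[OF X_tendsto_0, of d] by (simp add: dist_norm)

lemma origin_in_box: "(0, 0) \<in> box_at_origin T r"
  using T_pos r_pos by (simp add: box_at_origin_def)

lemma region_subset_box: "Reg Q \<subseteq> box_at_origin T r"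
proof -
  have "X w t < r" "- r < X w t" if "0 < t" "t < T" for w t
    using X_between[of t w] that by auto
  note b = this
  show ?thesis
    apply (cases Q; rename_tac K; case_tac K)
    apply (auto simp: box_at_origin_def)
    apply (meson b less_trans)+
    done
qed

lemma V_origin: "V (0, 0) = Vs"
proof -
  have "((\<lambda>x. V (0, x)) \<longlongrightarrow> V (0, 0)) (at_right 0)"
  proof (rule continuous_on_tendsto_compose[OF continuous_V _ origin_in_box])
    show "((\<lambda>x. (0, x)) \<longlongrightarrow> (0, 0)) (at_right 0)" by (intro tendsto_intros)
    show "\<forall>\<^sub>F x in at_right 0. (0, x) \<in> box_at_origin T r"
      using eventually_small[OF r_pos] eventually_at_right_less[of 0]
      by eventually_elim (use T_pos r_pos in \<open>auto simp: box_at_origin_def\<close>)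
  qed
  moreover have "((\<lambda>x. V (0, x)) \<longlongrightarrow> Vs) (at_right 0)"
  proof (rule Lim_transform_eventually)
    show "((\<lambda>x. Vs + x *\<^sub>R V0' R) \<longlongrightarrow> Vs) (at_right 0)" by (auto intro!: tendsto_eq_intros)
    show "\<forall>\<^sub>F x in at_right 0. Vs + x *\<^sub>R V0' R = V (0, x)"
      using eventually_small[OF r_pos] eventually_at_right_less[of 0]
      by eventually_elim (simp add: initial_R)
  qed
  ultimately show ?thesis by (rule tendsto_unique[rotated]) simp
qed

lemma rho_pos: "0 < rho Vs" and p11_pos: "0 < p11 Vs"
  using admissible_V[OF origin_in_box] unfolding V_origin admissible_def by blast+

lemma sound_speed_pos: "0 < sound_speed Vs"
  using rho_pos p11_pos by (simp add: sound_speed_def)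

lemma sound_speed_squared: "(sound_speed Vs)\<^sup>2 * rho Vs = 3 * p11 Vs"
proof -
  have "(sound_speed Vs)\<^sup>2 = 3 * p11 Vs / rho Vs"
    unfolding sound_speed_def by (rule real_sqrt_pow2) (use rho_pos p11_pos in simp)
  then show ?thesis using rho_pos by simp
qed

lemma X_deriv_origin: "(X w has_real_derivative wave_speed w Vs) (at 0 within {0..<T})"
  using X_deriv[of 0 w] T_pos unfolding X_0 V_origin by simp

lemma eventually_X_separate:
  assumes "wave_speed w Vs < wave_speed w' Vs"
  shows "\<exists>e>0. \<forall>\<^sub>F t in at_right 0. X w t + e * t < X w' t"
  using eventually_curves_separate[OF T_pos X_0 X_0 assms X_deriv_origin X_deriv_origin] assms
  by (intro exI[of _ "(wave_speed w' Vs - wave_speed w Vs) / 2"]) simp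

lemma slow_speed_between:
  "0 < sound_speed Vs / sqrt 3" "sound_speed Vs / sqrt 3 < sound_speed Vs"
proof -
  have sq3: "1 < sqrt (3::real)" by simp
  show "0 < sound_speed Vs / sqrt 3" "sound_speed Vs / sqrt 3 < sound_speed Vs"
    using sound_speed_pos sq3 by (simp_all add: divide_less_eq del: real_sqrt_gt_1_iff)
qed

text \<open>
  Since the speeds at the origin are strictly ordered, the gap to the next curve grows at least
  linearly in \<open>t\<close>, uniformly for the paths \<open>X(t) + e t\<close> with small \<open>e\<close>. For the outermost waves the
  next boundary is the edge of the box.
\<close>

lemma path_right_of_wave:
  "\<exists>e0>0. \<forall>\<^sub>F t in at_right 0. \<forall>e. 0 < e \<and> e < e0 \<longrightarrow> (t, X w t + 1 * e * t) \<in> Reg (right_region w)"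
proof -
  define Z where "Z = (case w of Wave1 \<Rightarrow> X Wave2 | Wave2 \<Rightarrow> X Contact | Contact \<Rightarrow> X Wave5
      | Wave5 \<Rightarrow> X Wave6 | Wave6 \<Rightarrow> (\<lambda>_. r))"
  have "\<exists>e0>0. \<forall>\<^sub>F t in at_right 0. X w t + e0 * t < Z t"
  proof (cases "w = Wave6")
    case True
    have half: "0 < r / 2" using r_pos by simp
    have "\<forall>\<^sub>F t in at_right 0. X w t + 1 * t < r"
      using X_near_0[OF half, of w] eventually_small[OF half] by eventually_elim auto
    then show ?thesis by (intro exI[of _ 1]) (simp add: Z_def True)
  next
    case False
    then show ?thesis
      unfolding Z_def using slow_speed_between by (cases w) (auto intro!: eventually_X_separate)
  qed
  then obtain e0 where "0 < e0" and e0: "\<forall>\<^sub>F t in at_right 0. X w t + e0 * t < Z t" by blast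
  have "\<forall>\<^sub>F t in at_right 0. \<forall>e. 0 < e \<and> e < e0 \<longrightarrow> (t, X w t + 1 * e * t) \<in> Reg (right_region w)"
    using e0 eventually_small[OF T_pos] eventually_at_right_less[of 0]
  proof eventually_elim
    case (elim t)
    have "X w t + e * t < Z t \<and> X w t < X w t + e * t" if "0 < e" "e < e0" for e
    proof -
      have "e * t < e0 * t" "0 < e * t" using that elim by (auto intro!: mult_strict_right_mono)
      then show ?thesis using elim by linarith
    qed
    then show ?case using elim by (cases w) (auto simp: Z_def)
  qed
  with \<open>0 < e0\<close> show ?thesis by blast
qed

lemma path_left_of_wave:
  "\<exists>e0>0. \<forall>\<^sub>F t in at_right 0. \<forall>e. 0 < e \<and> e < e0 \<longrightarrow> (t, X w t + -1 * e * t) \<in> Reg (left_region w)"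
proof -
  define Z where "Z = (case w of Wave2 \<Rightarrow> X Wave1 | Contact \<Rightarrow> X Wave2 | Wave5 \<Rightarrow> X Contact
      | Wave6 \<Rightarrow> X Wave5 | Wave1 \<Rightarrow> (\<lambda>_. - r))"
  have "\<exists>e0>0. \<forall>\<^sub>F t in at_right 0. Z t + e0 * t < X w t"
  proof (cases "w = Wave1")
    case True
    have half: "0 < r / 2" using r_pos by simp
    have "\<forall>\<^sub>F t in at_right 0. - r + 1 * t < X w t"
      using X_near_0[OF half, of w] eventually_small[OF half] by eventually_elim auto
    then show ?thesis by (intro exI[of _ 1]) (simp add: Z_def True)
  next
    case False
    then show ?thesis
      unfolding Z_def using slow_speed_between by (cases w) (auto intro!: eventually_X_separate)
  qed
  then obtain e0 where "0 < e0" and e0: "\<forall>\<^sub>F t in at_right 0. Z t + e0 * t < X w t" by blast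
  have "\<forall>\<^sub>F t in at_right 0. \<forall>e. 0 < e \<and> e < e0 \<longrightarrow> (t, X w t + -1 * e * t) \<in> Reg (left_region w)"
    using e0 eventually_small[OF T_pos] eventually_at_right_less[of 0]
  proof eventually_elim
    case (elim t)
    have "Z t < X w t - e * t \<and> X w t - e * t < X w t" if "0 < e" "e < e0" for e
    proof -
      have "e * t < e0 * t" "0 < e * t" using that elim by (auto intro!: mult_strict_right_mono)
      then show ?thesis using elim by linarith
    qed
    then show ?case using elim by (cases w) (auto simp: Z_def)
  qed
  with \<open>0 < e0\<close> show ?thesis by blast
qed

text \<open>
  This makes the limits at the origin unique, so that \<^const>\<open>origin_limit\<close> really denotes them.
\<close>

lemma origin_adherent_region: "at (0, 0) within Reg Q \<noteq> bot"
proof -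
  have "\<exists>w \<sigma> e0. 0 < e0 \<and> (\<forall>\<^sub>F t in at_right 0. \<forall>e. 0 < e \<and> e < e0 \<longrightarrow> (t, X w t + \<sigma> * e * t) \<in> Reg Q)"
    using region_adjacent_to_wave[of Q]
  proof (elim exE disjE)
    fix w assume "Q = left_region w"
    show ?thesis unfolding \<open>Q = left_region w\<close>
      by (rule exI[of _ w], rule exI[of _ "-1"], rule path_left_of_wave)
  next
    fix w assume "Q = right_region w"
    show ?thesis unfolding \<open>Q = right_region w\<close>
      by (rule exI[of _ w], rule exI[of _ 1], rule path_right_of_wave)
  qed
  then obtain w \<sigma> e0 where "0 < e0"
    and path: "\<forall>\<^sub>F t in at_right 0. \<forall>e. 0 < e \<and> e < e0 \<longrightarrow> (t, X w t + \<sigma> * e * t) \<in> Reg Q"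
    by blast
  have "filterlim (\<lambda>t. (t, X w t + \<sigma> * (e0 / 2) * t)) (at (0, 0) within Reg Q) (at_right 0)"
  proof (rule tendsto_origin_along_curve)
    show "\<forall>\<^sub>F t in at_right 0. (t, X w t + \<sigma> * (e0 / 2) * t) \<in> Reg Q"
      using path by eventually_elim (drule spec[of _ "e0 / 2"], use \<open>0 < e0\<close> in simp)
    show "((\<lambda>t. X w t + \<sigma> * (e0 / 2) * t) \<longlongrightarrow> 0) (at_right 0)"
      using X_tendsto_0 by (auto intro!: tendsto_eq_intros)
  qed
  then show ?thesis
    by (auto simp: filterlim_def filtermap_bot_iff bot_unique)
qed

lemma pdt_tendsto: "(pdt V \<longlongrightarrow> Vt Q) (at (0, 0) within Reg Q)"
  and pdx_tendsto: "(pdx V \<longlongrightarrow> Vx Q) (at (0, 0) within Reg Q)"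
  and differentiable_V: "p \<in> Reg Q \<Longrightarrow> V differentiable (at p)"
  using smooth[of Q] origin_adherent_region[of Q]
  unfolding smooth_with_limits_def origin_limit_def by (auto simp: tendsto_Lim)

lemma V_tendsto: "(V \<longlongrightarrow> Vs) (at (0, 0) within Reg Q)"
  using continuous_V origin_in_box region_subset_box[of Q] V_origin
  unfolding continuous_on_def by (metis tendsto_within_subset)

lemma material_deriv_tendsto:
    "(material_deriv V \<longlongrightarrow> Vt Q + u1 Vs *\<^sub>R Vx Q) (at (0, 0) within Reg Q)"
  unfolding material_deriv_def
  by (intro tendsto_intros pdt_tendsto pdx_tendsto tendsto_vec_nth[OF V_tendsto])

lemma DV_eq: "DV Q = Vt Q + u1 Vs *\<^sub>R Vx Q"
  unfolding origin_limit_def[of _ "material_deriv V"]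
  by (rule tendsto_Lim[OF origin_adherent_region material_deriv_tendsto])

lemma balance_at_origin: "ten_moment_balance (deriv W 0) Vs (Vx Q) (DV Q)"
proof (rule ten_moment_balance_limit[OF origin_adherent_region])
  obtain D where D: "\<And>x. (W has_vector_derivative D x) (at x)" "continuous_on UNIV D"
    using W_C1 unfolding C1_differentiable_on_def by auto
  then have "deriv W = D"
    by (auto intro!: ext DERIV_imp_deriv simp: has_real_derivative_iff_has_vector_derivative)
  then have "continuous_on UNIV (\<lambda>p. deriv W (snd p))"
    using continuous_on_compose2[OF D(2) continuous_on_snd[OF continuous_on_id]] by simp
  then have "((\<lambda>p. deriv W (snd p)) \<longlongrightarrow> deriv W (snd (0::real, 0))) (at (0, 0) within Reg Q)"
    unfolding continuous_on_def by (metis UNIV_I subset_UNIV tendsto_within_subset)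
  then show "((\<lambda>p. deriv W (snd p)) \<longlongrightarrow> deriv W 0) (at (0, 0) within Reg Q)" by simp
  show "\<forall>\<^sub>F p in at (0, 0) within Reg Q.
      ten_moment_balance (deriv W (snd p)) (V p) (pdx V p) (material_deriv V p)"
    using ten_moment by (auto simp: eventually_at_filter ten_moment_at_iff_balance)
qed (use rho_pos V_tendsto pdx_tendsto material_deriv_tendsto DV_eq in auto)

lemma limits_compatible_across_wave:
  "Vt (left_region w) + wave_speed w Vs *\<^sub>R Vx (left_region w) =
   Vt (right_region w) + wave_speed w Vs *\<^sub>R Vx (right_region w)"
proof -
  let ?X' = "\<lambda>t. wave_speed w (V (t, X w t))"
  have contVX: "continuous_on {0..<T} (\<lambda>t. V (t, X w t))"
    by (intro continuous_on_compose2[OF continuous_V] continuous_intros continuous_X)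
      (use X_between[of _ w] in \<open>auto simp: box_at_origin_def\<close>)
  have "rho (V (t, X w t)) \<noteq> 0" if "t \<in> {0..<T}" for t
    using admissible_V[of "(t, X w t)"] X_between[of t w] that
    by (auto simp: box_at_origin_def admissible_def)
  then have contX': "continuous_on {0..<T} ?X'"
    using contVX by (cases w) (auto simp: sound_speed_def intro!: continuous_intros)
  have quotient: "((\<lambda>t. (V (t, X w t) - V (0, 0)) /\<^sub>R t) \<longlongrightarrow> Vt Q + wave_speed w Vs *\<^sub>R Vx Q) (at_right 0)"
    if \<sigma>: "\<bar>\<sigma>\<bar> \<le> 1"
      and path: "\<exists>e0>0. \<forall>\<^sub>F t in at_right 0. \<forall>e. 0 < e \<and> e < e0 \<longrightarrow> (t, X w t + \<sigma> * e * t) \<in> Reg Q" for \<sigma> Q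
  proof -
    obtain e0 where "0 < e0"
      and e0: "\<forall>\<^sub>F t in at_right 0. \<forall>e. 0 < e \<and> e < e0 \<longrightarrow> (t, X w t + \<sigma> * e * t) \<in> Reg Q"
      using path by blast
    from difference_quotient_along_boundary_curve[OF T_pos continuous_V X_0 X_bound X_deriv contX'
        region_subset_box differentiable_V pdt_tendsto pdx_tendsto \<sigma> \<open>0 < e0\<close> e0]
    show ?thesis by (simp add: X_0 V_origin)
  qed
  show ?thesis
    by (rule tendsto_unique[OF _ quotient[OF _ path_left_of_wave] quotient[OF _ path_right_of_wave]]) auto
qed

lemma jump_relation:
  "DV (left_region w) + (wave_speed w Vs - u1 Vs) *\<^sub>R Vx (left_region w) =
   DV (right_region w) + (wave_speed w Vs - u1 Vs) *\<^sub>R Vx (right_region w)"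
  using limits_compatible_across_wave[of w] by (simp add: DV_eq algebra_simps)

lemma outer_slope: "Vx (Outer K) = V0' K"
proof (rule limit_slope_eq_initial_slope[OF T_pos continuous_V region_subset_box differentiable_V pdx_tendsto])
  fix d :: real assume "0 < d"
  define m where "m = min d r"
  have m: "0 < m" "m \<le> d" "m \<le> r" using \<open>0 < d\<close> r_pos by (auto simp: m_def)
  then have m3: "0 < m / 3" by simp
  show "\<exists>a b. a < b \<and> \<bar>a\<bar> < d \<and> \<bar>b\<bar> < d \<and> {a..b} \<subseteq> {-r<..<r} \<and>
      V (0, a) = Vs + a *\<^sub>R V0' K \<and> V (0, b) = Vs + b *\<^sub>R V0' K \<and>
      (\<forall>\<^sub>F t in at_right 0. {t} \<times> {a..b} \<subseteq> Reg (Outer K))"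
  proof (cases K)
    case L
    have seg: "\<forall>\<^sub>F t in at_right 0. {t} \<times> {- m / 2..- m / 3} \<subseteq> Reg (Outer K)"
      using X_near_0[OF m3, of Wave1] eventually_small[OF T_pos] eventually_at_right_less[of 0]
      by eventually_elim (use m in \<open>auto simp: L\<close>)
    show ?thesis
      by (rule exI[of _ "- m / 2"], rule exI[of _ "- m / 3"], intro conjI seg) (use m L initial_L[of "- m / 2"] initial_L[of "- m / 3"] in auto)
  next
    case R
    have seg: "\<forall>\<^sub>F t in at_right 0. {t} \<times> {m / 3..m / 2} \<subseteq> Reg (Outer K)"
      using X_near_0[OF m3, of Wave6] eventually_small[OF T_pos] eventually_at_right_less[of 0]
      by eventually_elim (use m in \<open>auto simp: R\<close>)
    show ?thesis
      by (rule exI[of _ "m / 3"], rule exI[of _ "m / 2"], intro conjI seg) (use m R initial_R[of "m / 3"] initial_R[of "m / 2"] in auto)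
  qed
qed

lemma inner_wave_continuity:
  assumes "w = Wave2 \<or> w = Contact \<or> w = Wave5"
  shows "u1 (Vx (left_region w)) = u1 (Vx (right_region w))"
    and "p11 (Vx (left_region w)) = p11 (Vx (right_region w))"
    and "p11 (DV (left_region w)) = p11 (DV (right_region w))"
proof -
  have "(wave_speed w Vs - u1 Vs)\<^sup>2 * rho Vs \<noteq> 3 * p11 Vs"
    using assms sound_speed_squared p11_pos by (auto simp: power_divide)
  from slopes_continuous_across_nonacoustic_wave[OF balance_at_origin balance_at_origin jump_relation _ this]
  show "u1 (Vx (left_region w)) = u1 (Vx (right_region w))"
    and "p11 (Vx (left_region w)) = p11 (Vx (right_region w))"
    and "p11 (DV (left_region w)) = p11 (DV (right_region w))"
    using rho_pos by auto
qed

text \<open>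
  The speed, relative to the fluid, of the acoustic wave that separates \<open>Outer K\<close> from \<open>Star K\<close>; its
  sign lets both sides be treated by one set of formulas.
\<close>

definition outward_speed :: "side \<Rightarrow> real" where
  "outward_speed K = (case K of L \<Rightarrow> - sound_speed Vs | R \<Rightarrow> sound_speed Vs)"

lemma outer_jump: "DV (Outer K) + outward_speed K *\<^sub>R Vx (Outer K) =
    DV (Star K) + outward_speed K *\<^sub>R Vx (Star K)"
  using jump_relation[of Wave1] jump_relation[of Wave6] by (cases K) (simp_all add: outward_speed_def)

lemma outward_speed_squared: "(outward_speed K)\<^sup>2 * rho Vs = 3 * p11 Vs"
  using sound_speed_squared by (cases K) (simp_all add: outward_speed_def)

lemmas star_relations = relations_across_acoustic_wave
  [OF balance_at_origin balance_at_origin outer_jump rho_pos p11_pos outward_speed_squared, unfolded outer_slope]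

text \<open>
  The two acoustic relations contain the unknowns \<open>D p\<^sub>1\<^sub>1\<close> and \<open>\<partial>\<^sub>xp\<^sub>1\<^sub>1\<close>, which are the same next to
  both waves. In their sum the slope cancels because the waves have opposite speeds.
\<close>

lemma p11_DV_star:
  assumes "Q \<in> {Star L, StarStar L, StarStar R, Star R}"
  shows "p11 (DV Q) = 3 * p11 Vs / (2 * sound_speed Vs) *
      (1 / rho Vs * (p11 (V0' R) - p11 (V0' L)) - sound_speed Vs * (u1 (V0' L) + u1 (V0' R)))"
proof -
  let ?c = "sound_speed Vs"
  note inner = inner_wave_continuity[of Wave2, simplified] inner_wave_continuity[of Contact, simplified]
    inner_wave_continuity[of Wave5, simplified]
  have same: "p11 (DV Q) = p11 (DV (Star L))" using assms inner by auto
  have two: "2 * p11 (DV (Star L)) = ?c * (p11 (V0' R) - p11 (V0' L)) - 3 * p11 Vs * (u1 (V0' L) + u1 (V0' R))"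
    using star_relations(1)[of L] star_relations(1)[of R] inner
    by (simp add: outward_speed_def algebra_simps)
  have "3 * p11 Vs / (?c * rho Vs) = ?c"
    using sound_speed_squared sound_speed_pos rho_pos
    by (simp add: divide_eq_eq power2_eq_square mult.assoc)
  then have half_c: "3 * p11 Vs / (2 * ?c) * (1 / rho Vs) = ?c / 2"
    using sound_speed_pos rho_pos by (simp add: field_simps)
  have half_p: "3 * p11 Vs / (2 * ?c) * ?c = 3 * p11 Vs / 2"
    using sound_speed_pos by simp
  have "p11 (DV Q) = ?c / 2 * (p11 (V0' R) - p11 (V0' L)) - 3 * p11 Vs / 2 * (u1 (V0' L) + u1 (V0' R))"
    unfolding same using two by simp
  then have "p11 (DV Q) = (3 * p11 Vs / (2 * ?c) * (1 / rho Vs)) * (p11 (V0' R) - p11 (V0' L))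
      - (3 * p11 Vs / (2 * ?c) * ?c) * (u1 (V0' L) + u1 (V0' R))"
    unfolding half_c half_p .
  then show ?thesis by (simp only: right_diff_distrib mult.assoc)
qed

end

section \<open>Time derivatives in the intermediate regions next to the acoustic waves\<close>

theorem theorem5p26:
  fixes W :: "real \<Rightarrow> real"
    and V0 V0' :: "side \<Rightarrow> real^6"
    and Vs :: "real^6"
    and T r :: real
    and X :: "wave \<Rightarrow> real \<Rightarrow> real"
    and V :: "real \<times> real \<Rightarrow> real^6"
    and cs :: real
    and Vt Vx DV :: "region \<Rightarrow> real^6"
  assumes sol: "acoustic_GRP_solution W V0 V0' Vs T r X V"
  defines "cs \<equiv> sound_speed Vs"
    and "Vt \<equiv> \<lambda>Q. origin_limit (region_set T r X Q) (pdt V)"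
    and "Vx \<equiv> \<lambda>Q. origin_limit (region_set T r X Q) (pdx V)"
    and "DV \<equiv> \<lambda>Q. origin_limit (region_set T r X Q) (material_deriv V)"
  shows "\<exists>Dp11.
    (\<forall>K. p11 (DV (Star K)) = Dp11 \<and> p11 (DV (StarStar K)) = Dp11) \<and>
    Dp11 = 3 * p11 Vs / (2 * cs) *
      (1 / rho Vs * (p11 (V0' R) - p11 (V0' L)) - cs * (u1 (V0' L) + u1 (V0' R))) \<and>
    (\<forall>K. u2 (Vt (Star K)) = u2 (DV (Star K)) +
      u1 Vs / p11 Vs * (p12 (DV (Star K)) - 2 * p12 Vs / (3 * p11 Vs) * Dp11)) \<and>
    (\<forall>K. p12 (Vt (Star K)) = p12 (DV (Star K)) + rho Vs * u1 Vs * u2 (DV (Star K))) \<and>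
    (\<forall>K. p22 (Vt (Star K)) = p22 (DV (Star K)) - u1 Vs * p22 (Vx (Star K))) \<and>
    (\<forall>K. p22 (DV (Star K)) =
      (p11 Vs * p22 Vs - 4 * (p12 Vs)\<^sup>2) / (3 * (p11 Vs)\<^sup>2) * Dp11 +
      2 * p12 Vs / p11 Vs * p12 (DV (Star K))) \<and>
    u2 (DV (Star L)) = - p12 (V0' L) / rho (V0 L) - cs * p12 (V0 L) / p11 Vs * u1 (V0' L)
      - p12 Vs * cs / (3 * (p11 Vs)\<^sup>2) * Dp11 \<and>
    u2 (DV (Star R)) = - p12 (V0' R) / rho (V0 R) + cs * p12 (V0 R) / p11 Vs * u1 (V0' R)
      + p12 Vs * cs / (3 * (p11 Vs)\<^sup>2) * Dp11 \<and>
    (\<forall>K. p12 (DV (Star K)) = p12 Vs / p11 Vs * Dp11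
      + p12 (V0 K) * u1 (V0' K) - p11 (V0 K) * u2 (V0' K)) \<and>
    p22 (Vx (Star L)) = 1 / cs * (p22 (DV (Star L)) + p22 (V0 L) * u1 (V0' L)
      + 2 * p12 (V0 L) * u2 (V0' L) + cs * p22 (V0' L)) \<and>
    p22 (Vx (Star R)) = 1 / cs * (- p22 (V0 R) * u1 (V0' R)
      - 2 * p12 (V0 R) * u2 (V0' R) + cs * p22 (V0' R) - p22 (DV (Star R)))"
proof -
  interpret acoustic_GRP W V0 V0' Vs T r X V by unfold_locales (rule sol)
  have cs: "cs > 0" "outward_speed L = - cs" "outward_speed R = cs"
    using sound_speed_pos by (simp_all add: cs_def outward_speed_def)
  define Dp11 where "Dp11 = 3 * p11 Vs / (2 * cs) *
      (1 / rho Vs * (p11 (V0' R) - p11 (V0' L)) - cs * (u1 (V0' L) + u1 (V0' R)))"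
  have D11: "p11 (DV (Star K)) = Dp11" "p11 (DV (StarStar K)) = Dp11" for K
    unfolding DV_def Dp11_def cs_def by (cases K; rule p11_DV_star; simp)+
  have r: "rho Vs \<noteq> 0" "p11 Vs \<noteq> 0" using rho_pos p11_pos by auto
  have D: "DV Q = Vt Q + u1 Vs *\<^sub>R Vx Q" for Q
    unfolding DV_def Vt_def Vx_def by (rule DV_eq)
  have bal: "ten_moment_balance (deriv W 0) Vs (Vx Q) (DV Q)" for Q
    unfolding DV_def Vx_def by (rule balance_at_origin)
  have lim: "origin_limit (region_set T r X Q) (material_deriv V) = DV Q"
    "origin_limit (region_set T r X Q) (pdx V) = Vx Q" for Q
    unfolding DV_def Vx_def by (rule refl)+
  note rel = star_relations[unfolded lim D11]
  have u1x: "u1 (Vx (Star K)) = - Dp11 / (3 * p11 Vs)" for K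
    using bal[of "Star K"] D11(1)[of K] r by (simp add: ten_moment_balance_def field_simps)
  have u2x: "u2 (Vx (Star K)) = - (p12 (DV (Star K)) - 2 * p12 Vs / (3 * p11 Vs) * Dp11) / p11 Vs" for K
  proof -
    have "p11 Vs * u2 (Vx (Star K)) = - p12 (DV (Star K)) - 2 * p12 Vs * u1 (Vx (Star K))"
      using bal[of "Star K"] by (simp add: ten_moment_balance_def)
    then show ?thesis using r unfolding u1x by (simp add: field_simps)
  qed
  have p12x: "p12 (Vx (Star K)) = - rho Vs * u2 (DV (Star K))" for K
    using bal[of "Star K"] r by (simp add: ten_moment_balance_def field_simps)
  have t: "Vt Q $ i = DV Q $ i - u1 Vs * Vx Q $ i" for Q i by (simp add: D)
  show ?thesis
  proof (intro exI[of _ Dp11] conjI allI)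
    show "Dp11 = 3 * p11 Vs / (2 * cs) *
      (1 / rho Vs * (p11 (V0' R) - p11 (V0' L)) - cs * (u1 (V0' L) + u1 (V0' R)))" by (fact Dp11_def)
    fix K
    show "u2 (Vt (Star K)) = u2 (DV (Star K)) +
      u1 Vs / p11 Vs * (p12 (DV (Star K)) - 2 * p12 Vs / (3 * p11 Vs) * Dp11)"
      unfolding t u2x using r by (simp add: field_simps)
    show "p12 (Vt (Star K)) = p12 (DV (Star K)) + rho Vs * u1 Vs * u2 (DV (Star K))"
      unfolding t p12x by simp
    show "p22 (Vt (Star K)) = p22 (DV (Star K)) - u1 Vs * p22 (Vx (Star K))" by (rule t)
    have "p22 (DV (Star K)) = - p22 Vs * u1 (Vx (Star K)) - 2 * p12 Vs * u2 (Vx (Star K))"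
      using bal[of "Star K"] by (simp add: ten_moment_balance_def)
    then show "p22 (DV (Star K)) =
      (p11 Vs * p22 Vs - 4 * (p12 Vs)\<^sup>2) / (3 * (p11 Vs)\<^sup>2) * Dp11 +
      2 * p12 Vs / p11 Vs * p12 (DV (Star K))"
      using r unfolding u1x u2x by (simp add: field_simps power2_eq_square)
    show "p12 (DV (Star K)) = p12 Vs / p11 Vs * Dp11
      + p12 (V0 K) * u1 (V0' K) - p11 (V0 K) * u2 (V0' K)"
      using rel(2)[of K] by (simp add: V0)
  next
    show "u2 (DV (Star L)) = - p12 (V0' L) / rho (V0 L) - cs * p12 (V0 L) / p11 Vs * u1 (V0' L)
      - p12 Vs * cs / (3 * (p11 Vs)\<^sup>2) * Dp11"
      using rel(3)[of L] by (simp add: V0 cs)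
    show "u2 (DV (Star R)) = - p12 (V0' R) / rho (V0 R) + cs * p12 (V0 R) / p11 Vs * u1 (V0' R)
      + p12 Vs * cs / (3 * (p11 Vs)\<^sup>2) * Dp11"
      using rel(3)[of R] by (simp add: V0 cs)
    show "p22 (Vx (Star L)) = 1 / cs * (p22 (DV (Star L)) + p22 (V0 L) * u1 (V0' L)
      + 2 * p12 (V0 L) * u2 (V0' L) + cs * p22 (V0' L))"
      using rel(4)[of L] less_imp_neq[OF cs(1)] by (simp add: V0 cs(2) field_simps)
    show "p22 (Vx (Star R)) = 1 / cs * (- p22 (V0 R) * u1 (V0' R)
      - 2 * p12 (V0 R) * u2 (V0' R) + cs * p22 (V0' R) - p22 (DV (Star R)))"
      using rel(4)[of R] less_imp_neq[OF cs(1)] by (simp add: V0 cs(3) field_simps)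
  qed (use D11 in auto)
qed

end
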